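(* Let $\mathcal{P}$ be a logic program with $|\mathcal{P}|=n$ and let $S$ be a set of invented rules. Let $s=\max\{\mathit{size}(c)\mid c\in\mathcal{P}\}$. Then MaxRefactor solves the optimal knowledge refactoring problem for $\mathcal{P}$ and $S$ when run with $K=\left\lceil \frac{n}{4}\right\rceil\left\lceil \frac{s-1}{2}\right\rceil$, i.e. with this $K$ it returns a refactored program $\mathcal{Q}$ of $\mathcal{P}$ such that $\mathit{size}(\mathcal{Q})\le\mathit{size}(\mathcal{Q}')$ for every refactored program $\mathcal{Q}'$ of $\mathcal{P}$.
   Context: A logic program is a finite set of definite rules $h\leftarrow a_1,\dots,a_m$; a literal is a predicate symbol applied to variables. $\mathit{size}(r)=|\mathit{body}(r)|+1$, $\mathit{size}(\mathcal{P})=\sum_{r\in\mathcal{P}}\mathit{size}(r)$. Unfolding: given $\mathcal{P}=\{c_1,\dots,c_N\}$ and a rule $r$ with no variables occurring only in its body, unfolding $\mathcal{P}$ upon $r$ gives $\{d_1,\dots,d_N\}$ where $d_i$ is the resolvent of $c_i$ and $r$ (resolving all body literals of $c_i$ unifiable with the head of $r$) if the head of $r$ unifies with some body literal of $c_i$, and $d_i=c_i$ otherwise; $\mathsf{unfold}(\mathcal{P},S)$ successively unfolds upon every rule of $S$. Invented rule (w.r.t. $\mathcal{P}$ and a finite variable set $\mathcal{X}$): its head predicate symbol does not occur in $\mathcal{P}$, its body predicate symbols occur in $\mathcal{P}$, its body variables lie in $\mathcal{X}$, and the head variables are exactly the body variables. A rule $r'$ is a refactored rule of $r$ w.r.t.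 a set $S$ of invented rules iff $\mathsf{unfold}(\{r'\},S)=\{r\}$; $\mathcal{I}(\mathcal{P},S)$ is the set of refactored rules of rules in $\mathcal{P}$. A refactored program of $\mathcal{P}$ is $\mathcal{Q}\subseteq\mathcal{P}\cup S\cup\mathcal{I}(\mathcal{P},S)$ with $\mathsf{unfold}(\mathcal{Q}\setminus S,\mathcal{Q}\cap S)=\mathcal{P}$. The optimal knowledge refactoring problem asks for a refactored program of minimum size. MaxRefactor is the procedure that, given $\mathcal{P}$, $S$ and a positive integer $K$, returns a refactored program of $\mathcal{P}$ of minimum size among those containing at most $K$ invented rules from $S$ (it searches for a set of $K$ candidate invented rules, each of which may or may not be used). *)

theory Defs
  imports Complex_Main "HOL-Library.FSet"
begin

datatype ('p, 'v) literal = Literal (pred: 'p) (args: "'v list")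

text \<open>Bodies are finite sets of literals.\<close>

datatype ('p, 'v) rule = Rule (head: "('p, 'v) literal") (body: "('p, 'v) literal fset")

definition lit_vars :: "('p, 'v) literal \<Rightarrow> 'v set" where
  "lit_vars l = set (args l)"

definition body_vars :: "('p, 'v) rule \<Rightarrow> 'v set" where
  "body_vars r = (\<Union>l \<in> fset (body r). lit_vars l)"

definition rule_vars :: "('p, 'v) rule \<Rightarrow> 'v set" where
  "rule_vars r = lit_vars (head r) \<union> body_vars r"

definition rule_preds :: "('p, 'v) rule \<Rightarrow> 'p set" where
  "rule_preds r = insert (pred (head r)) (pred ` fset (body r))"

definition program_preds :: "('p, 'v) rule set \<Rightarrow> 'p set" where
  "program_preds P = (\<Union>r \<in> P. rule_preds r)"

definition rule_size :: "('p, 'v) rule \<Rightarrow> nat" where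
  "rule_size r = fcard (body r) + 1"

definition program_size :: "('p, 'v) rule set \<Rightarrow> nat" where
  "program_size P = (\<Sum>r \<in> P. rule_size r)"

definition subst :: "('v \<Rightarrow> 'v) \<Rightarrow> ('p, 'v) literal \<Rightarrow> ('p, 'v) literal" where
  "subst \<theta> l = Literal (pred l) (map \<theta> (args l))"

text \<open>
  Standardizing apart: instead of renaming rules, every literal (or copy of a rule) that has to be
  variable-disjoint from the others gets a substitution of its own.  A pair of substitutions
  below stands for one substitution on the disjoint union of the two variable sets.
\<close>

definition unifiable :: "('p, 'v) literal \<Rightarrow> ('p, 'v) literal \<Rightarrow> bool" where
  "unifiable l l' \<longleftrightarrow> (\<exists>\<theta> \<tau>. subst \<theta> l = subst \<tau> l')"

definition resolved_lits :: "('p, 'v) rule \<Rightarrow> ('p, 'v) rule \<Rightarrow> ('p, 'v) literal set" where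
  "resolved_lits c r = {l \<in> fset (body c). unifiable l (head r)}"

text \<open>
  Each resolved literal \<open>l\<close> of \<open>c\<close> is unified with the head of its own copy of \<open>r\<close>;
  \<open>\<theta>\<close> acts on the variables of \<open>c\<close> and \<open>\<tau> l\<close> on those of the copy of \<open>r\<close> used for \<open>l\<close>.
\<close>

definition unifier ::
    "('p, 'v) rule \<Rightarrow> ('p, 'v) rule \<Rightarrow> ('v \<Rightarrow> 'v) \<Rightarrow> (('p, 'v) literal \<Rightarrow> 'v \<Rightarrow> 'v) \<Rightarrow> bool" where
  "unifier c r \<theta> \<tau> \<longleftrightarrow> (\<forall>l \<in> resolved_lits c r. subst \<theta> l = subst (\<tau> l) (head r))"

definition most_general_unifier ::
    "('p, 'v) rule \<Rightarrow> ('p, 'v) rule \<Rightarrow> ('v \<Rightarrow> 'v) \<Rightarrow> (('p, 'v) literal \<Rightarrow> 'v \<Rightarrow> 'v) \<Rightarrow> bool" where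
  "most_general_unifier c r \<theta> \<tau> \<longleftrightarrow> unifier c r \<theta> \<tau> \<and>
     (\<forall>\<theta>' \<tau>'. unifier c r \<theta>' \<tau>' \<longrightarrow>
        (\<exists>\<delta>. (\<forall>x \<in> rule_vars c. \<theta>' x = \<delta> (\<theta> x)) \<and>
             (\<forall>l \<in> resolved_lits c r. \<forall>x \<in> rule_vars r. \<tau>' l x = \<delta> (\<tau> l x))))"

text \<open>
  Most general unifiers, hence resolvents, are unique only up to renaming of variables,
  so resolution and unfolding are relations.
\<close>

definition resolvent :: "('p, 'v) rule \<Rightarrow> ('p, 'v) rule \<Rightarrow> ('p, 'v) rule \<Rightarrow> bool" where
  "resolvent c r d \<longleftrightarrow> (\<exists>\<theta> \<tau>. most_general_unifier c r \<theta> \<tau> \<and>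
     head d = subst \<theta> (head c) \<and>
     fset (body d) = subst \<theta> ` (fset (body c) - resolved_lits c r) \<union>
       (\<Union>l \<in> resolved_lits c r. subst (\<tau> l) ` fset (body r)))"

definition unfold_rule :: "('p, 'v) rule \<Rightarrow> ('p, 'v) rule \<Rightarrow> ('p, 'v) rule \<Rightarrow> bool" where
  "unfold_rule c r d \<longleftrightarrow> (if resolved_lits c r \<noteq> {} then resolvent c r d else d = c)"

text \<open>Unfolding upon \<open>r\<close> is only defined if no variable of \<open>r\<close> occurs in its body only.\<close>

definition unfold_upon ::
    "('p, 'v) rule set \<Rightarrow> ('p, 'v) rule \<Rightarrow> ('p, 'v) rule set \<Rightarrow> bool" where
  "unfold_upon P r Q \<longleftrightarrow> body_vars r \<subseteq> lit_vars (head r) \<and>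
     (\<exists>d. (\<forall>c \<in> P. unfold_rule c r (d c)) \<and> Q = d ` P)"

fun unfold_list ::
    "('p, 'v) rule set \<Rightarrow> ('p, 'v) rule list \<Rightarrow> ('p, 'v) rule set \<Rightarrow> bool" where
  "unfold_list P [] Q \<longleftrightarrow> Q = P"
| "unfold_list P (r # rs) Q \<longleftrightarrow> (\<exists>P'. unfold_upon P r P' \<and> unfold_list P' rs Q)"

text \<open>
  \<open>unfold P S Q\<close>: unfolding \<open>P\<close> successively upon every rule of \<open>S\<close>, in some order,
  yields \<open>Q\<close>.  The order matters only if heads of several rules of \<open>S\<close> unify, or if the body
  of one rule of \<open>S\<close> mentions the head predicate of another.
\<close>

definition unfold ::
    "('p, 'v) rule set \<Rightarrow> ('p, 'v) rule set \<Rightarrow> ('p, 'v) rule set \<Rightarrow> bool" where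
  "unfold P S Q \<longleftrightarrow> (\<exists>rs. distinct rs \<and> set rs = S \<and> unfold_list P rs Q)"

definition invented_rule :: "('p, 'v) rule set \<Rightarrow> 'v set \<Rightarrow> ('p, 'v) rule \<Rightarrow> bool" where
  "invented_rule P X r \<longleftrightarrow>
     pred (head r) \<notin> program_preds P \<and>
     pred ` fset (body r) \<subseteq> program_preds P \<and>
     body_vars r \<subseteq> X \<and>
     lit_vars (head r) = body_vars r"

definition refactored_rule ::
    "('p, 'v) rule set \<Rightarrow> ('p, 'v) rule \<Rightarrow> ('p, 'v) rule \<Rightarrow> bool" where
  "refactored_rule S r r' \<longleftrightarrow> unfold {r'} S {r}"

definition refactored_rules ::
    "('p, 'v) rule set \<Rightarrow> ('p, 'v) rule set \<Rightarrow> ('p, 'v) rule set" where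
  "refactored_rules P S = {r'. \<exists>r \<in> P. refactored_rule S r r'}"

text \<open>Finiteness is required because \<^const>\<open>refactored_rules\<close> contains all variants of its elements
  and is infinite in general, while programs are finite.\<close>

definition refactored_program ::
    "('p, 'v) rule set \<Rightarrow> ('p, 'v) rule set \<Rightarrow> ('p, 'v) rule set \<Rightarrow> bool" where
  "refactored_program P S Q \<longleftrightarrow> finite Q \<and>
     Q \<subseteq> P \<union> S \<union> refactored_rules P S \<and> unfold (Q - S) (Q \<inter> S) P"

definition optimal_refactored_program ::
    "('p, 'v) rule set \<Rightarrow> ('p, 'v) rule set \<Rightarrow> ('p, 'v) rule set \<Rightarrow> bool" where
  "optimal_refactored_program P S Q \<longleftrightarrow> refactored_program P S Q \<and>
     (\<forall>Q'. refactored_program P S Q' \<longrightarrow> program_size Q \<le> program_size Q')"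

text \<open>
  \<open>max_refactor P S K Q\<close>: \<open>Q\<close> is a possible output of MaxRefactor on input \<open>P\<close>, \<open>S\<close>, \<open>K\<close>
  (minimum-size refactored programs need not be unique).
\<close>

definition max_refactor ::
    "('p, 'v) rule set \<Rightarrow> ('p, 'v) rule set \<Rightarrow> nat \<Rightarrow> ('p, 'v) rule set \<Rightarrow> bool" where
  "max_refactor P S K Q \<longleftrightarrow> refactored_program P S Q \<and> card (Q \<inter> S) \<le> K \<and>
     (\<forall>Q'. refactored_program P S Q' \<and> card (Q' \<inter> S) \<le> K \<longrightarrow>
        program_size Q \<le> program_size Q')"

end

theory Submission
  imports Defs
begin

text \<open>
  Take an optimal refactored program with as few invented rules as possible.  Suppose that one of
  them has \<open>b\<close> body literals and is called \<open>u\<close> times, and that \<open>a\<close> body literals of \<open>P\<close> are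
  obtained through these calls only.  Replacing the calls by these literals eliminates the rule,
  so by the choice of the program it increases the size: \<open>a - u - (b + 1) > 0\<close>.  Since also
  \<open>a \<le> u * b\<close>, it follows that \<open>a \<ge> 8\<close>.  Different invented rules own disjoint sets of
  literals, hence there are at most \<open>n * (s - 1) / 8\<close> of them.
\<close>

section \<open>Substitutions and unification\<close>

lemma subst_id [simp]: "subst id l = l"
  by (cases l) (simp add: subst_def)

lemma subst_ident [simp]: "subst (\<lambda>x. x) l = l"
  using subst_id by (simp add: id_def)

lemma subst_subst: "subst \<theta> (subst \<tau> l) = subst (\<theta> \<circ> \<tau>) l"
  by (simp add: subst_def)

lemma pred_subst [simp]: "pred (subst \<theta> l) = pred l"
  by (simp add: subst_def)

lemma subst_eq_iff: "subst \<theta> l = subst \<tau> l \<longleftrightarrow> (\<forall>x \<in> lit_vars l. \<theta> x = \<tau> x)"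
  by (simp add: subst_def lit_vars_def)

lemma unifiable_pred: "unifiable l l' \<Longrightarrow> pred l = pred l'"
  by (metis pred_subst unifiable_def)

lemma unifiable_subst: "unifiable (subst \<theta> l) l' \<Longrightarrow> unifiable l l'"
  unfolding unifiable_def subst_subst by blast

lemma unifiable_instance: "unifiable (subst \<tau> l) l"
  unfolding unifiable_def by (metis subst_id)

section \<open>Instances, and expansion of all calls in one pass\<close>

definition inst :: "('v \<Rightarrow> 'v) \<Rightarrow> ('p, 'v) rule \<Rightarrow> ('p, 'v) rule" where
  "inst \<theta> c = Rule (subst \<theta> (head c)) (subst \<theta> |`| body c)"

text \<open>Only an inequality, because a substitution may identify body literals.\<close>

lemma rule_size_inst: "rule_size (inst \<theta> c) \<le> rule_size c"
  by (simp add: rule_size_def inst_def fcard.rep_eq card_image_le)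

text \<open>Successive unfolding resolves a literal upon the first rule whose head unifies with it;
  \<open>find\<close> records this priority.\<close>

definition resolver :: "('p, 'v) rule list \<Rightarrow> ('p, 'v) literal \<Rightarrow> ('p, 'v) rule option" where
  "resolver rs l = find (\<lambda>r. unifiable l (head r)) rs"

definition matching :: "('p, 'v) literal \<Rightarrow> ('p, 'v) literal \<Rightarrow> 'v \<Rightarrow> 'v" where
  "matching l h = (SOME \<tau>. subst \<tau> h = l)"

text \<open>One-sided unification: the head is instantiated while \<open>l\<close> stays fixed.
  Literals that no rule resolves are matched vacuously; for a matched call the choice in
  \<open>matching\<close> is a genuine matcher.\<close>

definition matched :: "('p, 'v) rule list \<Rightarrow> ('p, 'v) literal \<Rightarrow> bool" where
  "matched rs l \<longleftrightarrow> (\<forall>r. resolver rs l = Some r \<longrightarrow> (\<exists>\<tau>. subst \<tau> (head r) = l))"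

definition expansion :: "('p, 'v) rule list \<Rightarrow> ('p, 'v) literal \<Rightarrow> ('p, 'v) literal fset" where
  "expansion rs l = (case resolver rs l of None \<Rightarrow> {|l|}
     | Some r \<Rightarrow> subst (matching l (head r)) |`| body r)"

text \<open>A parallel replacement. For invented rules it can stand in for successive unfolding,
  since the inserted literals carry no invented predicate and are never expanded again.\<close>

definition flatten :: "('p, 'v) rule list \<Rightarrow> ('p, 'v) rule \<Rightarrow> ('p, 'v) rule" where
  "flatten rs c = Rule (head c) (ffUnion (expansion rs |`| body c))"

lemma resolver_Nil [simp]: "resolver [] l = None"
  by (simp add: resolver_def)

lemma resolver_Cons:
  "resolver (r # rs) l = (if unifiable l (head r) then Some r else resolver rs l)"
  by (simp add: resolver_def)

lemma resolver_SomeD: "resolver rs l = Some r \<Longrightarrow> r \<in> set rs \<and> unifiable l (head r)"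
  by (induction rs) (auto simp: resolver_Cons split: if_splits)

lemma resolver_removeAll: "resolver rs l \<noteq> Some r \<Longrightarrow> resolver (removeAll r rs) l = resolver rs l"
  by (induction rs) (auto simp: resolver_Cons split: if_splits)

lemma head_flatten [simp]: "head (flatten rs c) = head c"
  by (simp add: flatten_def)

lemma fset_body_flatten: "fset (body (flatten rs c)) = (\<Union>l \<in> fset (body c). fset (expansion rs l))"
  by (simp add: flatten_def ffUnion.rep_eq)

lemma rule_eqI: "head c = head d \<Longrightarrow> fset (body c) = fset (body d) \<Longrightarrow> c = d"
  by (cases c; cases d) (simp add: fset_inject)

lemma subst_matching: "\<exists>\<tau>. subst \<tau> h = l \<Longrightarrow> subst (matching l h) h = l"
  unfolding matching_def by (rule someI_ex[of "\<lambda>\<tau>. subst \<tau> h = l"])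

text \<open>A matcher is determined on the head variables, and all body variables are among them, so
  the arbitrary choice in \<open>matching\<close> does not affect the expansion.\<close>

lemma expansion_instance:
  assumes "body_vars r \<subseteq> lit_vars (head r)" "resolver rs (subst \<tau> (head r)) = Some r"
  shows "expansion rs (subst \<tau> (head r)) = subst \<tau> |`| body r"
proof -
  let ?\<sigma> = "matching (subst \<tau> (head r)) (head r)"
  have "subst ?\<sigma> (head r) = subst \<tau> (head r)"
    by (rule subst_matching) blast
  then have "\<forall>x \<in> lit_vars (head r). ?\<sigma> x = \<tau> x"
    by (simp add: subst_eq_iff)
  then have "subst ?\<sigma> l = subst \<tau> l" if "l |\<in>| body r" for l
    using assms(1) that by (auto simp: subst_eq_iff body_vars_def)
  then have "subst ?\<sigma> |`| body r = subst \<tau> |`| body r"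
    by (intro fset.map_cong0) auto
  then show ?thesis
    using assms(2) by (simp add: expansion_def)
qed

text \<open>Stands in for \<open>invented_rule\<close>, with \<open>V\<close> as the predicates of
  the program, so that flattening can be studied without fixing a program.\<close>

definition auxiliary :: "'p set \<Rightarrow> ('p, 'v) rule \<Rightarrow> bool" where
  "auxiliary V r \<longleftrightarrow> pred (head r) \<notin> V \<and> pred ` fset (body r) \<subseteq> V \<and>
     body_vars r \<subseteq> lit_vars (head r)"

lemma resolver_base:
  assumes "\<forall>r \<in> set rs. auxiliary V r" "pred l \<in> V"
  shows "resolver rs l = None"
  by (metis assms auxiliary_def not_None_eq resolver_SomeD unifiable_pred)

lemma expansion_base:
  assumes "\<forall>r \<in> set rs. auxiliary V r" "pred l \<in> V"
  shows "expansion rs l = {|l|}"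
  using resolver_base[OF assms] by (simp add: expansion_def)

lemma matched_base:
  assumes "\<forall>r \<in> set rs. auxiliary V r" "pred l \<in> V"
  shows "matched rs l"
  using resolver_base[OF assms] by (simp add: matched_def)

lemma flatten_base:
  assumes "\<forall>r \<in> set rs. auxiliary V r" "rule_preds c \<subseteq> V"
  shows "flatten rs c = c"
proof (rule rule_eqI)
  have "expansion rs l = {|l|}" if "l \<in> fset (body c)" for l
    using assms(2) that by (intro expansion_base[OF assms(1)]) (auto simp: rule_preds_def)
  then show "fset (body (flatten rs c)) = fset (body c)"
    by (simp add: fset_body_flatten)
qed simp

section \<open>Successive unfolding compared with flattening\<close>

fun derives :: "('p, 'v) rule list \<Rightarrow> ('p, 'v) rule \<Rightarrow> ('p, 'v) rule \<Rightarrow> bool" where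
  "derives [] c p \<longleftrightarrow> p = c"
| "derives (r # rs) c p \<longleftrightarrow> (\<exists>d. unfold_rule c r d \<and> derives rs d p)"

text \<open>Unfolding treats the rules of a program independently, so it splits into derivations of
  single rules; composing the choice functions of the steps gives \<open>f\<close>.\<close>

lemma unfold_list_derives:
  "unfold_list C rs D \<Longrightarrow> \<exists>f. (\<forall>c \<in> C. derives rs c (f c)) \<and> D = f ` C"
proof (induction rs arbitrary: C)
  case Nil
  then show ?case by (intro exI[of _ id]) auto
next
  case (Cons r rs)
  then obtain d where d: "\<forall>c \<in> C. unfold_rule c r (d c)" and u: "unfold_list (d ` C) rs D"
    by (auto simp: unfold_upon_def)
  from Cons.IH[OF u] obtain f where "\<forall>c \<in> d ` C. derives rs c (f c)" "D = f ` d ` C"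
    by blast
  with d show ?case
    by (intro exI[of _ "f \<circ> d"]) auto
qed

text \<open>One form for both cases: when nothing is resolved, the identity substitution and an
  empty union reproduce \<open>c\<close>.\<close>

lemma unfold_ruleE:
  assumes "unfold_rule c r d"
  obtains \<theta> \<tau> where "\<forall>l \<in> resolved_lits c r. subst \<theta> l = subst (\<tau> l) (head r)"
    "head d = subst \<theta> (head c)"
    "fset (body d) = subst \<theta> ` (fset (body c) - resolved_lits c r) \<union>
       (\<Union>l \<in> resolved_lits c r. subst (\<tau> l) ` fset (body r))"
proof (cases "resolved_lits c r = {}")
  case True
  with assms have "d = c" by (simp add: unfold_rule_def)
  with True show ?thesis by (intro that[of id "\<lambda>_. id"]) auto
next
  case False
  with assms show ?thesis
    by (auto simp: unfold_rule_def resolvent_def most_general_unifier_def unifier_def intro: that)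
qed

text \<open>Instantiating a rule in advance with the composition of all the unifiers used later on
  turns every unification into a matching.\<close>

lemma derives_flatten:
  assumes "\<forall>r \<in> set rs. auxiliary V r" "derives rs c p"
  shows "\<exists>\<theta>. flatten rs (inst \<theta> c) = p \<and> (\<forall>l \<in> fset (body (inst \<theta> c)). matched rs l)"
  using assms
proof (induction rs arbitrary: c)
  case Nil
  then show ?case
    by (intro exI[of _ id] conjI rule_eqI)
       (auto simp: inst_def fset_body_flatten expansion_def matched_def)
next
  case (Cons r rs)
  then obtain d where "unfold_rule c r d" "derives rs d p" and r: "auxiliary V r"
    and rs: "\<forall>r \<in> set rs. auxiliary V r"
    by auto
  let ?R = "resolved_lits c r"
  obtain \<theta> \<tau> where u: "\<forall>l \<in> ?R. subst \<theta> l = subst (\<tau> l) (head r)"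
    and hd: "head d = subst \<theta> (head c)"
    and bd: "fset (body d) = subst \<theta> ` (fset (body c) - ?R) \<union>
       (\<Union>l \<in> ?R. subst (\<tau> l) ` fset (body r))"
    using \<open>unfold_rule c r d\<close> by (rule unfold_ruleE)
  obtain \<theta>' where p: "flatten rs (inst \<theta>' d) = p"
    and m: "\<forall>l \<in> fset (body (inst \<theta>' d)). matched rs l"
    using Cons.IH[OF rs \<open>derives rs d p\<close>] by blast
  \<comment> \<open>\<open>\<theta>'\<close> collects the unifiers for the remaining rules, so
    \<open>?\<sigma>\<close> is what \<open>c\<close> undergoes in the whole derivation.\<close>
  let ?\<sigma> = "\<theta>' \<circ> \<theta>"
  have res: "resolver (r # rs) (subst ?\<sigma> l) = Some r"
    "subst ?\<sigma> l = subst (\<theta>' \<circ> \<tau> l) (head r)" if "l \<in> ?R" for l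
  proof -
    show eq: "subst ?\<sigma> l = subst (\<theta>' \<circ> \<tau> l) (head r)"
      using u that by (metis subst_subst)
    show "resolver (r # rs) (subst ?\<sigma> l) = Some r"
      unfolding eq resolver_Cons by (simp add: unifiable_instance)
  qed
  \<comment> \<open>Contraposition of \<open>unifiable_subst\<close>: instantiation cannot bring an
    unresolved literal within the reach of \<open>r\<close>.\<close>
  have nres: "resolver (r # rs) (subst ?\<sigma> l) = resolver rs (subst ?\<sigma> l)"
    if "l \<in> fset (body c) - ?R" for l
    using that unifiable_subst by (fastforce simp: resolver_Cons resolved_lits_def)
  have expR: "fset (expansion (r # rs) (subst ?\<sigma> l)) =
      (\<Union>k \<in> fset (body r). fset (expansion rs (subst \<theta>' (subst (\<tau> l) k))))" if "l \<in> ?R" for l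
  proof -
    have "expansion (r # rs) (subst ?\<sigma> l) = subst (\<theta>' \<circ> \<tau> l) |`| body r"
      using res[OF that] r expansion_instance by (metis auxiliary_def)
    moreover have "expansion rs (subst \<theta>' (subst (\<tau> l) k)) = {|subst (\<theta>' \<circ> \<tau> l) k|}"
      if "k \<in> fset (body r)" for k
      unfolding subst_subst using r that by (intro expansion_base[OF rs]) (auto simp: auxiliary_def)
    ultimately show ?thesis by auto
  qed
  have expN: "expansion (r # rs) (subst ?\<sigma> l) = expansion rs (subst \<theta>' (subst \<theta> l))"
    if "l \<in> fset (body c) - ?R" for l
    using nres[OF that] by (simp add: expansion_def subst_subst)
  have split: "fset (body c) = (fset (body c) - ?R) \<union> ?R"
    by (auto simp: resolved_lits_def)
  have "fset (body (flatten (r # rs) (inst ?\<sigma> c))) =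
      (\<Union>l \<in> fset (body c). fset (expansion (r # rs) (subst ?\<sigma> l)))"
    by (simp add: fset_body_flatten inst_def)
  also have "\<dots> = (\<Union>l \<in> fset (body c) - ?R. fset (expansion rs (subst \<theta>' (subst \<theta> l)))) \<union>
      (\<Union>l \<in> ?R. \<Union>k \<in> fset (body r). fset (expansion rs (subst \<theta>' (subst (\<tau> l) k))))"
    by (subst split) (simp only: UN_Un expN expR cong: SUP_cong)
  also have "\<dots> = fset (body (flatten rs (inst \<theta>' d)))"
    by (simp add: fset_body_flatten inst_def bd UN_Un)
  finally have "flatten (r # rs) (inst ?\<sigma> c) = p"
    using p by (intro rule_eqI) (auto simp: inst_def hd subst_subst)
  moreover have "matched (r # rs) (subst ?\<sigma> l)" if l: "l \<in> fset (body c)" for l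
  proof (cases "l \<in> ?R")
    case True
    then show ?thesis using res by (metis matched_def option.inject)
  next
    case False
    then have "matched rs (subst \<theta>' (subst \<theta> l))"
      using m l bd by (auto simp: inst_def)
    then show ?thesis using nres l False by (simp add: matched_def subst_subst)
  qed
  then have "\<forall>l \<in> fset (body (inst ?\<sigma> c)). matched (r # rs) l"
    by (simp add: inst_def)
  ultimately show ?case by blast
qed

text \<open>Where the head of \<open>r\<close> matches, a most general unifier can be chosen to be the identity on
  the variables of \<open>c\<close>, so the resolvent is exactly the flattened rule.\<close>

lemma unfold_rule_flatten:
  assumes "auxiliary V r" and m: "\<forall>l \<in> fset (body c). matched [r] l"
  shows "unfold_rule c r (flatten [r] c)"
proof (cases "resolved_lits c r = {}")
  case True
  then have "resolver [r] l = None" if "l \<in> fset (body c)" for l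
    using that by (auto simp: resolver_Cons resolved_lits_def)
  then have "flatten [r] c = c"
    by (intro rule_eqI) (auto simp: fset_body_flatten expansion_def)
  with True show ?thesis by (simp add: unfold_rule_def)
next
  case False
  let ?R = "resolved_lits c r"
  let ?\<tau> = "\<lambda>l. matching l (head r)"
  have res: "resolver [r] l = (if l \<in> ?R then Some r else None)" if "l \<in> fset (body c)" for l
    using that by (auto simp: resolver_Cons resolved_lits_def)
  have sub: "?R \<subseteq> fset (body c)" by (auto simp: resolved_lits_def)
  have \<tau>: "subst (?\<tau> l) (head r) = l" if "l \<in> ?R" for l
  proof (rule subst_matching)
    show "\<exists>\<tau>. subst \<tau> (head r) = l"
      using m res[of l] that sub by (auto simp: matched_def)
  qed
  have "most_general_unifier c r id ?\<tau>"
    unfolding most_general_unifier_def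
  proof (intro conjI allI impI)
    show "unifier c r id ?\<tau>"
      using \<tau> by (simp add: unifier_def)
  next
    fix \<theta>' \<tau>'
    assume u: "unifier c r \<theta>' \<tau>'"
    \<comment> \<open>The candidate is \<open>id\<close> on \<open>c\<close>, so the factor
      \<open>\<delta>\<close> is taken to be \<open>\<theta>'\<close>. Agreement on the head of
      \<open>r\<close> extends to all its variables.\<close>
    have "\<tau>' l x = \<theta>' (?\<tau> l x)" if l: "l \<in> ?R" and x: "x \<in> rule_vars r" for l x
    proof -
      have "subst (\<tau>' l) (head r) = subst \<theta>' (subst (?\<tau> l) (head r))"
        using u l \<tau>[OF l] by (simp add: unifier_def)
      then have "\<forall>x \<in> lit_vars (head r). \<tau>' l x = (\<theta>' \<circ> ?\<tau> l) x"
        unfolding subst_subst subst_eq_iff .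
      then show ?thesis
        using x assms(1) by (auto simp: auxiliary_def rule_vars_def)
    qed
    then show "\<exists>\<delta>. (\<forall>x \<in> rule_vars c. \<theta>' x = \<delta> (id x)) \<and>
        (\<forall>l \<in> ?R. \<forall>x \<in> rule_vars r. \<tau>' l x = \<delta> (?\<tau> l x))"
      by (intro exI[of _ \<theta>']) simp
  qed
  moreover have "fset (body (flatten [r] c)) =
      subst id ` (fset (body c) - ?R) \<union> (\<Union>l \<in> ?R. subst (?\<tau> l) ` fset (body r))"
  proof -
    have "fset (expansion [r] l) = (if l \<in> ?R then subst (?\<tau> l) ` fset (body r) else {l})"
      if "l \<in> fset (body c)" for l
      using res[OF that] by (simp add: expansion_def)
    then have "fset (body (flatten [r] c)) =
        (\<Union>l \<in> fset (body c). if l \<in> ?R then subst (?\<tau> l) ` fset (body r) else {l})"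
      by (simp add: fset_body_flatten)
    also have "\<dots> = (fset (body c) - ?R) \<union> (\<Union>l \<in> ?R. subst (?\<tau> l) ` fset (body r))"
      using sub by (auto split: if_splits)
    finally show ?thesis by simp
  qed
  ultimately have "resolvent c r (flatten [r] c)"
    unfolding resolvent_def by (intro exI[of _ id] exI[of _ ?\<tau>]) simp
  with False show ?thesis by (simp add: unfold_rule_def)
qed

lemma matched_Cons_single: "matched (r # rs) l \<Longrightarrow> matched [r] l"
  by (auto simp: matched_def resolver_Cons)

text \<open>A literal is either consumed by \<open>r\<close>, and what it yields has predicates in
  \<open>V\<close> and is inert for \<open>rs\<close>, or it is passed unchanged to
  \<open>rs\<close>.\<close>

lemma flatten_Cons:
  assumes aux: "\<forall>r \<in> set (r # rs). auxiliary V r"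
    and m: "\<forall>l \<in> fset (body c). matched (r # rs) l"
  shows "flatten rs (flatten [r] c) = flatten (r # rs) c"
    and "\<forall>l \<in> fset (body (flatten [r] c)). matched rs l"
proof -
  have rs: "\<forall>r \<in> set rs. auxiliary V r" using aux by simp
  have "(\<Union>k \<in> fset (expansion [r] l). fset (expansion rs k)) = fset (expansion (r # rs) l) \<and>
      (\<forall>k \<in> fset (expansion [r] l). matched rs k)" if l: "l \<in> fset (body c)" for l
  proof (cases "unifiable l (head r)")
    case True
    have "expansion rs k = {|k|} \<and> matched rs k" if "k \<in> fset (expansion [r] l)" for k
    proof -
      have "pred k \<in> V"
        using that True aux by (auto simp: expansion_def resolver_Cons auxiliary_def)
      then show ?thesis using expansion_base[OF rs] matched_base[OF rs] by blast
    qed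
    then show ?thesis
      using True by (simp add: expansion_def resolver_Cons)
  next
    case False
    then show ?thesis
      using m l by (auto simp: expansion_def resolver_Cons matched_def)
  qed
  then show "flatten rs (flatten [r] c) = flatten (r # rs) c"
    "\<forall>l \<in> fset (body (flatten [r] c)). matched rs l"
    by (auto intro!: rule_eqI simp: fset_body_flatten)
qed

text \<open>The converse of \<open>derives_flatten\<close>: if all calls match, flattening each rule
  is a legitimate unfolding, with no renaming of its variables.\<close>

lemma unfold_list_flatten:
  assumes "\<forall>r \<in> set rs. auxiliary V r" "\<forall>c \<in> C. \<forall>l \<in> fset (body c). matched rs l"
  shows "unfold_list C rs (flatten rs ` C)"
  using assms
proof (induction rs arbitrary: C)
  case Nil
  have "flatten [] c = c" if "c \<in> C" for c
    by (intro rule_eqI) (auto simp: fset_body_flatten expansion_def)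
  then show ?case by simp
next
  case (Cons r rs)
  have fl: "flatten rs (flatten [r] c) = flatten (r # rs) c"
    "\<forall>l \<in> fset (body (flatten [r] c)). matched rs l" if "c \<in> C" for c
    using flatten_Cons[OF Cons.prems(1)] Cons.prems(2) that by blast+
  have "unfold_rule c r (flatten [r] c)" if "c \<in> C" for c
    using Cons.prems that by (intro unfold_rule_flatten[of V]) (auto intro: matched_Cons_single)
  then have "unfold_upon C r (flatten [r] ` C)"
    using Cons.prems(1) by (auto simp: unfold_upon_def auxiliary_def)
  moreover have "unfold_list (flatten [r] ` C) rs (flatten rs ` flatten [r] ` C)"
    using Cons.prems(1) fl(2) by (intro Cons.IH) auto
  moreover have "flatten rs ` flatten [r] ` C = flatten (r # rs) ` C"
    using fl(1) by (force simp: image_iff)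
  ultimately show ?case by auto
qed

lemma unfold_list_append:
  "unfold_list A xs B \<Longrightarrow> unfold_list B ys C \<Longrightarrow> unfold_list A (xs @ ys) C"
  by (induction xs arbitrary: A) auto

locale refactoring =
  fixes P S :: "('p, 'v) rule set" and X :: "'v set"
  assumes fin: "finite P" and inv: "\<forall>r \<in> S. invented_rule P X r"
begin

lemma auxiliary_invented: "r \<in> S \<Longrightarrow> auxiliary (program_preds P) r"
  using inv by (auto simp: auxiliary_def invented_rule_def)

lemma rule_preds_program: "p \<in> P \<Longrightarrow> rule_preds p \<subseteq> program_preds P"
  by (auto simp: program_preds_def)

text \<open>Invented heads have fresh predicates. As flattening preserves heads, this keeps folded
  program rules out of \<open>S\<close>.\<close>

lemma program_head_notin_S: "p \<in> P \<Longrightarrow> head c = head p \<Longrightarrow> c \<notin> S"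
  using inv by (fastforce simp: invented_rule_def program_preds_def rule_preds_def)

lemma program_body_pred: "p \<in> P \<Longrightarrow> l \<in> fset (body p) \<Longrightarrow> pred l \<in> program_preds P"
  using rule_preds_program by (fastforce simp: rule_preds_def)

text \<open>Program rules contain no calls. Hence an unfolding upon some rules of \<open>S\<close>
  that ends in program rules extends to further rules of \<open>S\<close>.\<close>

lemma unfold_list_program:
  assumes "set rs \<subseteq> S" "C \<subseteq> P"
  shows "unfold_list C rs C"
proof -
  have aux: "\<forall>r \<in> set rs. auxiliary (program_preds P) r"
    using assms(1) auxiliary_invented by blast
  have "flatten rs c = c" if "c \<in> C" for c
    using that assms(2) rule_preds_program by (intro flatten_base[OF aux]) auto
  then have "flatten rs ` C = C" by simp
  moreover have "unfold_list C rs (flatten rs ` C)"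
    using assms(2) program_body_pred by (intro unfold_list_flatten[OF aux])
      (auto intro!: matched_base[OF aux])
  ultimately show ?thesis by simp
qed

definition folding :: "('p, 'v) rule list \<Rightarrow> (('p, 'v) rule \<Rightarrow> ('p, 'v) rule) \<Rightarrow> bool" where
  "folding rs e \<longleftrightarrow> distinct rs \<and> set rs \<subseteq> S \<and>
     (\<forall>p \<in> P. flatten rs (e p) = p \<and> (\<forall>l \<in> fset (body (e p)). matched rs l))"

definition cost :: "('p, 'v) rule list \<Rightarrow> (('p, 'v) rule \<Rightarrow> ('p, 'v) rule) \<Rightarrow> nat" where
  "cost rs e = (\<Sum>p \<in> P. rule_size (e p)) + (\<Sum>r \<in> set rs. rule_size r)"

lemma refactored_program_folding:
  assumes "refactored_program P S Q"
  shows "\<exists>rs e. folding rs e \<and> set rs = Q \<inter> S \<and> cost rs e \<le> program_size Q"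
proof -
  from assms obtain rs where rs: "distinct rs" "set rs = Q \<inter> S" "unfold_list (Q - S) rs P"
    and Q: "finite Q"
    by (auto simp: refactored_program_def unfold_def)
  have aux: "\<forall>r \<in> set rs. auxiliary (program_preds P) r"
    using rs(2) auxiliary_invented by blast
  obtain f where f: "\<forall>c \<in> Q - S. derives rs c (f c)" "P = f ` (Q - S)"
    using unfold_list_derives[OF rs(3)] by blast
  \<comment> \<open>Several rules of \<open>Q\<close> may unfold to the same rule of
    \<open>P\<close>; \<open>g\<close> keeps one of them.\<close>
  define g where "g = inv_into (Q - S) f"
  have g: "g p \<in> Q - S" "f (g p) = p" if "p \<in> P" for p
    using that f(2) inv_into_into f_inv_into_f unfolding g_def by metis+
  have "\<forall>p \<in> P. \<exists>\<theta>. flatten rs (inst \<theta> (g p)) = p \<and>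
      (\<forall>l \<in> fset (body (inst \<theta> (g p))). matched rs l)"
  proof
    fix p assume p: "p \<in> P"
    then have "derives rs (g p) p"
      using f(1) g by metis
    then show "\<exists>\<theta>. flatten rs (inst \<theta> (g p)) = p \<and>
        (\<forall>l \<in> fset (body (inst \<theta> (g p))). matched rs l)"
      by (rule derives_flatten[OF aux])
  qed
  then obtain \<theta> where \<theta>: "\<forall>p \<in> P. flatten rs (inst (\<theta> p) (g p)) = p \<and>
      (\<forall>l \<in> fset (body (inst (\<theta> p) (g p))). matched rs l)"
    by metis
  let ?e = "\<lambda>p. inst (\<theta> p) (g p)"
  have "folding rs ?e"
    using rs \<theta> by (simp add: folding_def)
  moreover have "cost rs ?e \<le> program_size Q"
  proof -
    have "inj_on g P"
      by (metis g(2) inj_onI)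
    have "(\<Sum>p \<in> P. rule_size (?e p)) \<le> (\<Sum>p \<in> P. rule_size (g p))"
      by (intro sum_mono rule_size_inst)
    also have "\<dots> = sum rule_size (g ` P)"
      using \<open>inj_on g P\<close> by (simp add: sum.reindex)
    also have "\<dots> \<le> sum rule_size (Q - S)"
      using Q g(1) by (intro sum_mono2) auto
    finally have "cost rs ?e \<le> sum rule_size (Q - S) + sum rule_size (Q \<inter> S)"
      by (simp add: cost_def rs(2))
    also have "\<dots> = program_size Q"
      using Q by (simp add: program_size_def sum.Int_Diff[of Q _ S])
    finally show ?thesis .
  qed
  ultimately show ?thesis using rs(2) by blast
qed

text \<open>The way back. Size is preserved exactly because \<open>flatten rs\<close> is a left
  inverse of \<open>e\<close> on \<open>P\<close>, which makes \<open>e\<close> injective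
  there.\<close>

lemma folding_refactored_program:
  assumes "folding rs e" "finite S"
  shows "\<exists>Q. refactored_program P S Q \<and> Q \<inter> S = set rs \<and> program_size Q = cost rs e"
proof -
  have rs: "distinct rs" "set rs \<subseteq> S"
    and e: "\<And>p. p \<in> P \<Longrightarrow> flatten rs (e p) = p"
      "\<And>p l. p \<in> P \<Longrightarrow> l \<in> fset (body (e p)) \<Longrightarrow> matched rs l"
    using assms(1) by (auto simp: folding_def)
  have aux: "\<forall>r \<in> set rs. auxiliary (program_preds P) r"
    using rs(2) auxiliary_invented by blast
  have unf: "unfold_list (e ` C) rs C" if "C \<subseteq> P" for C
  proof -
    have "flatten rs ` e ` C = C"
      using e(1) that by (force simp: image_iff)
    then show ?thesis
      using unfold_list_flatten[OF aux, of "e ` C"] e(2) that by auto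
  qed
  have disj: "e ` P \<inter> S = {}"
  proof -
    have "e p \<notin> S" if "p \<in> P" for p
      using program_head_notin_S[OF that] head_flatten[of rs "e p"] e(1)[OF that] by simp
    then show ?thesis by blast
  qed
  define Q where "Q = e ` P \<union> set rs"
  have QS: "Q \<inter> S = set rs" "Q - S = e ` P"
    using disj rs(2) by (auto simp: Q_def)
  obtain ys where ys: "set ys = S - set rs" "distinct ys"
    using assms(2) finite_distinct_list by (metis finite_Diff)
  have "e p \<in> refactored_rules P S" if p: "p \<in> P" for p
  proof -
    have "unfold_list {e p} rs {p}"
      using unf[of "{p}"] p by simp
    moreover have "unfold_list {p} ys {p}"
      using p ys by (intro unfold_list_program) auto
    ultimately have "unfold_list {e p} (rs @ ys) {p}"
      by (rule unfold_list_append)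
    then have "unfold {e p} S {p}"
      unfolding unfold_def using rs ys by (intro exI[of _ "rs @ ys"]) auto
    then show ?thesis
      using p by (auto simp: refactored_rules_def refactored_rule_def)
  qed
  then have "Q \<subseteq> P \<union> S \<union> refactored_rules P S"
    using rs(2) by (auto simp: Q_def)
  moreover have "unfold (Q - S) (Q \<inter> S) P"
    unfolding unfold_def QS using rs(1) unf[of P] by blast
  ultimately have "refactored_program P S Q"
    using fin by (simp add: refactored_program_def Q_def)
  moreover have "program_size Q = cost rs e"
  proof -
    have "inj_on e P"
      by (metis e(1) inj_onI)
    have "program_size Q = sum rule_size (e ` P) + sum rule_size (set rs)"
      unfolding program_size_def Q_def
      using fin disj rs(2) by (intro sum.union_disjoint) auto
    then show ?thesis
      using \<open>inj_on e P\<close> by (simp add: cost_def sum.reindex)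
  qed
  ultimately show ?thesis using QS(1) by blast
qed

section \<open>Calls of an invented rule and the literals it owns\<close>

definition calls :: "('p, 'v) rule list \<Rightarrow> (('p, 'v) rule \<Rightarrow> ('p, 'v) rule) \<Rightarrow>
    ('p, 'v) rule \<Rightarrow> ('p, 'v) rule \<Rightarrow> ('p, 'v) literal set" where
  "calls rs e r p = {l \<in> fset (body (e p)). resolver rs l = Some r}"

text \<open>The body literals of \<open>p\<close> that would be lost if the calls of
  \<open>r\<close> were deleted from \<open>e p\<close>. Summed over \<open>P\<close>, the
  cardinality is the \<open>a\<close> of the overview, as that of \<open>calls\<close> is
  \<open>u\<close>.\<close>

definition exclusive :: "('p, 'v) rule list \<Rightarrow> (('p, 'v) rule \<Rightarrow> ('p, 'v) rule) \<Rightarrow>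
    ('p, 'v) rule \<Rightarrow> ('p, 'v) rule \<Rightarrow> ('p, 'v) literal set" where
  "exclusive rs e r p = fset (body p) -
     (\<Union>l \<in> fset (body (e p)) - calls rs e r p. fset (expansion rs l))"

lemma folding_body:
  "folding rs e \<Longrightarrow> p \<in> P \<Longrightarrow> fset (body p) = (\<Union>l \<in> fset (body (e p)). fset (expansion rs l))"
  by (metis fset_body_flatten folding_def)

lemma finite_calls: "finite (calls rs e r p)"
  by (simp add: calls_def)

lemma finite_exclusive: "finite (exclusive rs e r p)"
  by (simp add: exclusive_def)

text \<open>Every exclusive literal comes from a call, and a call yields at most one literal per
  body literal of \<open>r\<close>. Summed over \<open>P\<close> this becomes
  \<open>a \<le> u * b\<close>.\<close>

lemma card_exclusive_le:
  assumes "folding rs e" "p \<in> P"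
  shows "card (exclusive rs e r p) \<le> card (calls rs e r p) * fcard (body r)"
proof -
  have "exclusive rs e r p \<subseteq> (\<Union>l \<in> calls rs e r p. fset (expansion rs l))"
    using folding_body[OF assms] by (auto simp: exclusive_def)
  then have "card (exclusive rs e r p) \<le> card (\<Union>l \<in> calls rs e r p. fset (expansion rs l))"
    by (intro card_mono) (auto simp: finite_calls)
  also have "\<dots> \<le> (\<Sum>l \<in> calls rs e r p. card (fset (expansion rs l)))"
    by (intro card_UN_le finite_calls)
  also have "\<dots> \<le> (\<Sum>l \<in> calls rs e r p. fcard (body r))"
  proof (intro sum_mono)
    fix l assume "l \<in> calls rs e r p"
    then have "expansion rs l = subst (matching l (head r)) |`| body r"
      by (simp add: calls_def expansion_def)
    then show "card (fset (expansion rs l)) \<le> fcard (body r)"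
      by (simp add: fcard.rep_eq card_image_le)
  qed
  finally show ?thesis by simp
qed

text \<open>A literal exclusive to two rules would stem from one call resolved by both, but
  \<open>resolver\<close> is a function.\<close>

lemma sum_card_exclusive_le:
  assumes "folding rs e" "p \<in> P"
  shows "(\<Sum>r \<in> set rs. card (exclusive rs e r p)) \<le> fcard (body p)"
proof -
  have "exclusive rs e r p \<inter> exclusive rs e r' p = {}" if "r \<noteq> r'" for r r'
  proof (rule ccontr)
    assume "exclusive rs e r p \<inter> exclusive rs e r' p \<noteq> {}"
    then obtain x where x: "x \<in> exclusive rs e r p" "x \<in> exclusive rs e r' p"
      by blast
    then obtain l where "l \<in> fset (body (e p))" "x \<in> fset (expansion rs l)"
      using folding_body[OF assms] by (auto simp: exclusive_def)
    with x have "l \<in> calls rs e r p" "l \<in> calls rs e r' p"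
      by (auto simp: exclusive_def)
    with that show False by (simp add: calls_def)
  qed
  then have "(\<Sum>r \<in> set rs. card (exclusive rs e r p)) = card (\<Union>r \<in> set rs. exclusive rs e r p)"
    by (intro card_UN_disjoint[symmetric]) (auto simp: finite_exclusive)
  also have "\<dots> \<le> card (fset (body p))"
    by (intro card_mono) (auto simp: exclusive_def)
  finally show ?thesis by (simp add: fcard.rep_eq)
qed

text \<open>Only the exclusive literals must replace the calls; the rest is still produced
  elsewhere. Dropping \<open>r\<close> changes the resolver of no remaining literal, and the
  inserted literals resolve with nothing. The additive form avoids truncated subtraction.\<close>

lemma folding_remove:
  assumes fold: "folding rs e"
  shows "\<exists>e'. folding (removeAll r rs) e' \<and> (\<forall>p \<in> P.
    rule_size (e' p) + card (calls rs e r p) \<le> rule_size (e p) + card (exclusive rs e r p))"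
proof -
  let ?rs = "removeAll r rs"
  let ?B = "\<lambda>p. fset (body (e p)) - calls rs e r p \<union> exclusive rs e r p"
  define e' where "e' p = Rule (head p) (Abs_fset (?B p))" for p
  have body: "fset (body (e' p)) = ?B p" for p
    by (simp add: e'_def Abs_fset_inverse finite_exclusive)
  have aux: "\<forall>r' \<in> set ?rs. auxiliary (program_preds P) r'"
    using fold auxiliary_invented by (auto simp: folding_def)
  have keep: "resolver ?rs l = resolver rs l" if "l \<in> fset (body (e p)) - calls rs e r p" for l p
    using that by (intro resolver_removeAll) (auto simp: calls_def)
  have excl: "pred l \<in> program_preds P" if "l \<in> exclusive rs e r p" "p \<in> P" for l p
    using that program_body_pred by (auto simp: exclusive_def)
  have "flatten ?rs (e' p) = p" if p: "p \<in> P" for p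
  proof (intro rule_eqI)
    show "head (flatten ?rs (e' p)) = head p" by (simp add: e'_def)
    have "fset (body (flatten ?rs (e' p))) = (\<Union>l \<in> ?B p. fset (expansion ?rs l))"
      by (simp add: fset_body_flatten body)
    also have "\<dots> = (\<Union>l \<in> fset (body (e p)) - calls rs e r p. fset (expansion rs l)) \<union>
        exclusive rs e r p"
    proof -
      have "expansion ?rs l = expansion rs l" if "l \<in> fset (body (e p)) - calls rs e r p" for l
        using keep[OF that] by (simp add: expansion_def)
      moreover have "expansion ?rs l = {|l|}" if "l \<in> exclusive rs e r p" for l
        using excl[OF that p] by (rule expansion_base[OF aux])
      ultimately show ?thesis by (simp add: UN_Un)
    qed
    also have "\<dots> = fset (body p)"
      using folding_body[OF fold p] by (auto simp: exclusive_def)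
    finally show "fset (body (flatten ?rs (e' p))) = fset (body p)" .
  qed
  moreover have "matched ?rs l" if p: "p \<in> P" and l: "l \<in> fset (body (e' p))" for p l
  proof (cases "l \<in> exclusive rs e r p")
    case True
    then show ?thesis using excl p matched_base[OF aux] by blast
  next
    case False
    then have l': "l \<in> fset (body (e p)) - calls rs e r p"
      using l body by simp
    then have "matched rs l" using fold p by (simp add: folding_def)
    then show ?thesis using keep[OF l'] by (simp add: matched_def)
  qed
  ultimately have "folding ?rs e'"
    using fold by (auto simp: folding_def distinct_removeAll)
  moreover have "rule_size (e' p) + card (calls rs e r p) \<le>
      rule_size (e p) + card (exclusive rs e r p)" for p
  proof -
    have sub: "calls rs e r p \<subseteq> fset (body (e p))" by (auto simp: calls_def)
    have "card (?B p) \<le> card (fset (body (e p)) - calls rs e r p) + card (exclusive rs e r p)"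
      by (rule card_Un_le)
    moreover have "card (fset (body (e p)) - calls rs e r p) + card (calls rs e r p) =
        card (fset (body (e p)))"
      using sub card_mono[OF _ sub] by (simp add: card_Diff_subset finite_calls)
    ultimately show ?thesis
      by (simp add: rule_size_def fcard.rep_eq body)
  qed
  ultimately show ?thesis by blast
qed

text \<open>The extremal cases are four calls of a rule with two body literals, three calls with three
  and two calls with four.\<close>

lemma eight_le:
  fixes a b u :: nat
  assumes "u + b + 2 \<le> a" "a \<le> u * b"
  shows "8 \<le> a"
proof (rule ccontr)
  assume "\<not> 8 \<le> a"
  \<comment> \<open>A counterexample has \<open>a \<le> 7\<close>, hence
    \<open>u + b \<le> 5\<close>, which leaves finitely many cases.\<close>
  with assms(1) have "u \<le> 5" "b \<le> 5" by simp_all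
  then have "u \<in> {0, 1, 2, 3, 4, 5}" "b \<in> {0, 1, 2, 3, 4, 5}" by auto
  with assms \<open>\<not> 8 \<le> a\<close> show False by auto
qed

text \<open>Double counting: each invented rule owns at least eight literals over all of
  \<open>P\<close>, and within one \<open>p\<close> the owned sets are disjoint.\<close>

lemma minimal_folding_length:
  assumes fold: "folding rs e"
    and min: "\<And>r e'. r \<in> set rs \<Longrightarrow> folding (removeAll r rs) e' \<Longrightarrow>
      cost rs e < cost (removeAll r rs) e'"
  shows "8 * card (set rs) \<le> (\<Sum>p \<in> P. fcard (body p))"
proof -
  have "8 \<le> (\<Sum>p \<in> P. card (exclusive rs e r p))" if r: "r \<in> set rs" for r
  proof -
    obtain e' where e': "folding (removeAll r rs) e'"
      "\<forall>p \<in> P. rule_size (e' p) + card (calls rs e r p) \<le> rule_size (e p) + card (exclusive rs e r p)"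
      using folding_remove[OF fold] by blast
    have "(\<Sum>p \<in> P. rule_size (e' p)) + (\<Sum>p \<in> P. card (calls rs e r p)) \<le>
        (\<Sum>p \<in> P. rule_size (e p)) + (\<Sum>p \<in> P. card (exclusive rs e r p))"
      unfolding sum.distrib[symmetric] using e'(2) by (intro sum_mono) auto
    moreover have "sum rule_size (set rs) = rule_size r + sum rule_size (set rs - {r})"
      using r by (simp add: sum.remove)
    \<comment> \<open>The \<open>2\<close> is one for the head of \<open>r\<close> in
      \<open>rule_size\<close> and one for the strictness in \<open>min\<close>.\<close>
    ultimately have "(\<Sum>p \<in> P. card (calls rs e r p)) + fcard (body r) + 2 \<le>
        (\<Sum>p \<in> P. card (exclusive rs e r p))"
      using min[OF r e'(1)] by (simp add: cost_def rule_size_def)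
    moreover have "(\<Sum>p \<in> P. card (exclusive rs e r p)) \<le>
        (\<Sum>p \<in> P. card (calls rs e r p)) * fcard (body r)"
      unfolding sum_distrib_right using card_exclusive_le[OF fold] by (intro sum_mono) auto
    ultimately show ?thesis by (rule eight_le)
  qed
  then have "8 * card (set rs) \<le> (\<Sum>r \<in> set rs. \<Sum>p \<in> P. card (exclusive rs e r p))"
    using sum_bounded_below[of "set rs" "8::nat"] by (simp add: mult.commute)
  also have "\<dots> = (\<Sum>p \<in> P. \<Sum>r \<in> set rs. card (exclusive rs e r p))"
    by (rule sum.swap)
  also have "\<dots> \<le> (\<Sum>p \<in> P. fcard (body p))"
    using sum_card_exclusive_le[OF fold] by (intro sum_mono) auto
  finally show ?thesis .
qed

section \<open>An optimal program with few invented rules\<close>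

lemma refactored_program_refl: "refactored_program P S P" "P \<inter> S = {}"
proof -
  show "P \<inter> S = {}" using program_head_notin_S by blast
  then show "refactored_program P S P"
    using fin by (auto simp: refactored_program_def Diff_triv unfold_def)
qed

text \<open>Unfolding is only defined upon finite sets, so an infinite \<open>S\<close> has no refactored rules.\<close>

lemma infinite_S_refactored_program:
  assumes "infinite S" "refactored_program P S Q"
  shows "P \<subseteq> Q"
proof -
  have "refactored_rules P S = {}"
    using assms(1) by (auto simp: refactored_rules_def refactored_rule_def unfold_def)
  with assms(2) have sub: "Q - S \<subseteq> P" and "unfold (Q - S) (Q \<inter> S) P"
    by (auto simp: refactored_program_def)
  then obtain rs where rs: "set rs = Q \<inter> S" "unfold_list (Q - S) rs P"
    by (auto simp: unfold_def)
  obtain f where f: "\<forall>c \<in> Q - S. derives rs c (f c)" "P = f ` (Q - S)"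
    using unfold_list_derives[OF rs(2)] by blast
  have "finite (Q - S)" using assms(2) by (simp add: refactored_program_def)
  \<comment> \<open>\<open>f\<close> maps \<open>Q - S\<close>, a subset of the finite
    \<open>P\<close>, onto \<open>P\<close>, which forces equality.\<close>
  then have "card P \<le> card (Q - S)" using f(2) card_image_le by blast
  then have "Q - S = P" using sub fin card_seteq by blast
  then show ?thesis by blast
qed

text \<open>Two minimisations: size first, then the number of invented rules among optimal programs.
  The second makes removing a rule strictly more expensive, as \<open>minimal_folding_length\<close>
  requires.\<close>

lemma optimal_few_invented:
  "\<exists>Q. optimal_refactored_program P S Q \<and> 8 * card (Q \<inter> S) \<le> (\<Sum>p \<in> P. fcard (body p))"
proof (cases "finite S")
  case False
  have "program_size P \<le> program_size Q" if "refactored_program P S Q" for Q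
    using infinite_S_refactored_program[OF False that] that
    unfolding program_size_def by (intro sum_mono2) (auto simp: refactored_program_def)
  then show ?thesis
    using refactored_program_refl by (intro exI[of _ P]) (auto simp: optimal_refactored_program_def)
next
  case True
  obtain Q1 where "optimal_refactored_program P S Q1"
    using ex_has_least_nat[of "refactored_program P S" P program_size] refactored_program_refl(1)
    unfolding optimal_refactored_program_def by blast
  then obtain Q where Q: "optimal_refactored_program P S Q"
    "\<And>Q'. optimal_refactored_program P S Q' \<Longrightarrow> card (Q \<inter> S) \<le> card (Q' \<inter> S)"
    using ex_has_least_nat[of "optimal_refactored_program P S" Q1 "\<lambda>Q. card (Q \<inter> S)"] by blast
  obtain rs e where rs: "folding rs e" "set rs = Q \<inter> S" "cost rs e \<le> program_size Q"
    using refactored_program_folding Q(1) unfolding optimal_refactored_program_def by blast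
  have "8 * card (set rs) \<le> (\<Sum>p \<in> P. fcard (body p))"
  proof (rule minimal_folding_length[OF rs(1)])
    fix r e' assume r: "r \<in> set rs" and e': "folding (removeAll r rs) e'"
    obtain Q' where Q': "refactored_program P S Q'" "Q' \<inter> S = set rs - {r}"
      "program_size Q' = cost (removeAll r rs) e'"
      using folding_refactored_program[OF e' True] by auto
    have "card (Q' \<inter> S) < card (Q \<inter> S)"
      unfolding Q'(2) rs(2)[symmetric] using r by (intro card_Diff1_less) auto
    \<comment> \<open>The minimal count excludes \<open>Q'\<close> from the optimal programs, so its
      size strictly exceeds that of \<open>Q\<close>, which bounds \<open>cost rs e\<close>.\<close>
    then have "\<not> optimal_refactored_program P S Q'"
      using Q(2) by (metis not_less)
    then have "program_size Q < program_size Q'"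
      using Q(1) Q'(1) unfolding optimal_refactored_program_def by (meson le_trans not_less)
    then show "cost rs e < cost (removeAll r rs) e'"
      using rs(3) Q'(3) by simp
  qed
  then show ?thesis using Q(1) rs(2) by auto
qed

end

section \<open>Rounding and the conclusion\<close>

lemma le_rounded_eighth:
  fixes n s m :: nat
  assumes "8 * m \<le> n * (s - 1)"
  shows "m \<le> nat (\<lceil>real n / 4\<rceil> * \<lceil>(real s - 1) / 2\<rceil>)"
\<comment> \<open>For \<open>s = 0\<close> the truncated \<open>s - 1\<close> differs from
  \<open>real s - 1\<close>; there, as for \<open>n = 0\<close>, the assumption gives
  \<open>m = 0\<close>.\<close>
proof (cases "n = 0 \<or> s = 0")
  case True
  then show ?thesis using assms by auto
next
  case False
  have "real (8 * m) \<le> real (n * (s - 1))"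
    using assms by (simp only: of_nat_le_iff)
  with False have "8 * real m \<le> real n * (real s - 1)"
    by (simp add: of_nat_diff)
  moreover have "real n / 4 * ((real s - 1) / 2) = real n * (real s - 1) / 8"
    by simp
  ultimately have "real m \<le> real n / 4 * ((real s - 1) / 2)"
    by linarith
  \<comment> \<open>Rounding up each factor enlarges the product, as both factors are nonnegative
    for \<open>1 \<le> s\<close>.\<close>
  also have "\<dots> \<le> real_of_int \<lceil>real n / 4\<rceil> * real_of_int \<lceil>(real s - 1) / 2\<rceil>"
    using False by (intro mult_mono) auto
  finally have "int m \<le> \<lceil>real n / 4\<rceil> * \<lceil>(real s - 1) / 2\<rceil>"
    by (simp flip: of_int_mult)
  then show ?thesis by linarith
qed

theorem theorem3:
  fixes P S :: "('p, 'v) rule set" and X :: "'v set" and n s K :: nat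
  assumes "finite P"
    and "finite X"
    and "\<forall>r \<in> S. invented_rule P X r"
    and "n = card P"
    and "s = Max (rule_size ` P)"
    and "K = nat (\<lceil>real n / 4\<rceil> * \<lceil>(real s - 1) / 2\<rceil>)"
  shows "(\<exists>Q. max_refactor P S K Q) \<and>
    (\<forall>Q. max_refactor P S K Q \<longrightarrow> optimal_refactored_program P S Q)"
proof -
  interpret refactoring P S X
    using assms by unfold_locales
  obtain Q where Q: "optimal_refactored_program P S Q"
    "8 * card (Q \<inter> S) \<le> (\<Sum>p \<in> P. fcard (body p))"
    using optimal_few_invented by blast
  \<comment> \<open>If \<open>P\<close> is empty, \<open>s\<close> is the \<open>Max\<close> of the
    empty set, but then this is vacuous and \<open>n = 0\<close>.\<close>
  have "fcard (body p) \<le> s - 1" if "p \<in> P" for p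
  proof -
    have "rule_size p \<le> s"
      using assms that by simp
    then show ?thesis by (simp add: rule_size_def)
  qed
  then have "(\<Sum>p \<in> P. fcard (body p)) \<le> n * (s - 1)"
    using sum_bounded_above[of P "\<lambda>p. fcard (body p)" "s - 1"] assms(4) by simp
  then have K: "card (Q \<inter> S) \<le> K"
    unfolding assms(6) using Q(2) by (intro le_rounded_eighth) simp
  \<comment> \<open>Since some optimal program respects the bound \<open>K\<close>, the minimum
    under that bound is the unrestricted one.\<close>
  have "max_refactor P S K Q"
    using Q(1) K by (simp add: max_refactor_def optimal_refactored_program_def)
  moreover have "optimal_refactored_program P S Q'" if "max_refactor P S K Q'" for Q'
    using that Q(1) K unfolding max_refactor_def optimal_refactored_program_def
    by (meson le_trans)
  ultimately show ?thesis by blast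
qed

end
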